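(* Let $A$ be an $m\times n$ real matrix with $n>m$ and ${\rm rank}(A)=m$, with columns ${\bf a}_1,\ldots,{\bf a}_n\in\mathbb{R}^m$, let ${\bf b}\in\mathbb{R}^m$, and let $P=\{{\bf x}\in\mathbb{R}^n: x_1,\ldots,x_n\geq 0,\ A{\bf x}={\bf b}\}$. Let $X=(X_1,\ldots,X_n)$ be the maximum-entropy random vector described in the context, with parameters $q_j$ and $z_j={\bf E}[X_j]$. Then $$|P\cap\mathbb{Z}^n|\ \leq\ e^{H(X)}\min_{{\bf a}_{j_1},\ldots,{\bf a}_{j_m}\ \text{lin. indep.}}(1-q_{j_1})(1-q_{j_2})\cdots(1-q_{j_m})\ =\ e^{H(X)}\min_{{\bf a}_{j_1},\ldots,{\bf a}_{j_m}\ \text{lin. indep.}}\prod_{i=1}^m\frac{1}{z_{j_i}+1},$$ where the minimum is over all choices of $m$ linearly independent columns of $A$.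
   Context: $X=(X_1,\ldots,X_n)$ is the random vector with values in $\mathbb{Z}_{\geq 0}^n$ of maximum entropy subject to ${\bf E}[AX]={\bf b}$ (assumed to exist), where the entropy is $H(X)=-\sum_{{\bf k}\in\mathbb{Z}_{\geq0}^n}{\bf Pr}[X={\bf k}]\ln{\bf Pr}[X={\bf k}]$. Its coordinates are independent and geometrically distributed: there are $q_j\in[0,1)$ with ${\bf Pr}[X_j=k]=(1-q_j)q_j^k$ for $k\in\mathbb{Z}_{\geq0}$, and $z_j:={\bf E}[X_j]=q_j/(1-q_j)$. *)

theory Defs
  imports "HOL-Probability.Probability"
begin

definition polyhedron_P :: "real^'n^'m \<Rightarrow> real^'m \<Rightarrow> (real^'n) set" where
  "polyhedron_P A b = {x. (\<forall>j. 0 \<le> x $ j) \<and> A *v x = b}"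

definition integer_points :: "(real^'n) set" where
  "integer_points = {x. \<forall>j. x $ j \<in> \<int>}"

text \<open>A random vector with values in \<open>\<int>\<^sub>\<ge>\<^sub>0\<^sup>n\<close> is represented by its law, a
  \<^typ>\<open>(nat^'n) pmf\<close>; the random vector itself is the identity on that space.\<close>

definition real_vec :: "nat^'n \<Rightarrow> real^'n" where
  "real_vec k = (\<chi> j. real (k $ j))"

text \<open>\<^term>\<open>ln 0 = (0::real)\<close>, so the convention \<open>0 ln 0 = 0\<close> is built in.
  An infinite sum of reals that diverges has the default value 0; by lemma
  \<open>entropy_summable\<close> below this never happens for vectors of finite expectation.\<close>

definition entropy_H :: "(nat^'n) pmf \<Rightarrow> real" where
  "entropy_H p = - (\<Sum>\<^sub>\<infinity>k\<in>UNIV. pmf p k * ln (pmf p k))"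

text \<open>\<open>E[AX] = b\<close>. The integral defaults to 0 for non-integrable functions, so existence of the
  expectation \<open>E[X]\<close> is required explicitly.\<close>

definition feasible_law :: "real^'n^'m \<Rightarrow> real^'m \<Rightarrow> (nat^'n) pmf \<Rightarrow> bool" where
  "feasible_law A b p \<longleftrightarrow>
     integrable (measure_pmf p) real_vec \<and>
     measure_pmf.expectation p (\<lambda>k. A *v real_vec k) = b"

definition max_entropy_law :: "real^'n^'m \<Rightarrow> real^'m \<Rightarrow> (nat^'n) pmf \<Rightarrow> bool" where
  "max_entropy_law A b p \<longleftrightarrow>
     feasible_law A b p \<and> (\<forall>p'. feasible_law A b p' \<longrightarrow> entropy_H p' \<le> entropy_H p)"

text \<open>Choices of \<open>m\<close> column indices whose columns are linearly independent. Injectivity excludes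
  repeated columns, which the set-based \<^const>\<open>independent\<close> cannot see.\<close>

definition column_bases :: "real^'n^'m \<Rightarrow> 'n set set" where
  "column_bases A =
     {J. card J = CARD('m) \<and> inj_on (\<lambda>j. column j A) J \<and> independent ((\<lambda>j. column j A) ` J)}"

lemma entropy_summable:
  fixes p :: "(nat^'n) pmf"
  assumes "integrable (measure_pmf p) real_vec"
  shows "(\<lambda>k. pmf p k * ln (pmf p k)) summable_on UNIV"
proof -
  define w where "w = map_pmf vec_lambda (Pi_pmf (UNIV :: 'n set) (0::nat) (\<lambda>_. geometric_pmf (1/2)))"
  define L where "L k = (\<Sum>j\<in>UNIV. (real (k $ j) + 1) * ln 2)" for k :: "nat^'n"
  have L0: "L k \<ge> 0" for k
    unfolding L_def by (intro sum_nonneg) auto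
  have pmf_w: "pmf w k = (\<Prod>j\<in>UNIV. (1/2) ^ (k $ j) * (1/2))" for k
  proof -
    have "inj (vec_lambda :: ('n \<Rightarrow> nat) \<Rightarrow> nat^'n)"
      by (rule injI) (metis vec_lambda_inverse UNIV_I)
    then have "pmf w (vec_lambda (vec_nth k)) =
        pmf (Pi_pmf (UNIV :: 'n set) (0::nat) (\<lambda>_. geometric_pmf (1/2))) (vec_nth k)"
      unfolding w_def by (rule pmf_map_inj')
    then show ?thesis by (simp add: pmf_Pi)
  qed
  have w_pos: "pmf w k > 0" for k
    unfolding pmf_w by (intro prod_pos) auto
  have ln_w: "ln (pmf w k) = - L k" for k
    unfolding pmf_w L_def
    by (subst ln_prod) (auto simp: ln_mult ln_realpow ln_div algebra_simps sum_negf sum_subtractf sum.distrib)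
  have bound: "norm (pmf p k * ln (pmf p k)) \<le> pmf w k + pmf p k * L k" for k
  proof (cases "pmf p k = 0")
    case True
    then show ?thesis by simp
  next
    case False
    then have pos: "pmf p k > 0" by (simp add: pmf_pos)
    have "ln (pmf w k / pmf p k) \<le> pmf w k / pmf p k - 1"
      using pos w_pos by (intro ln_le_minus_one) simp
    then have "pmf p k * ln (pmf w k / pmf p k) \<le> pmf p k * (pmf w k / pmf p k - 1)"
      using pos by (intro mult_left_mono) auto
    also have "\<dots> = pmf w k - pmf p k"
      using pos by (simp add: field_simps)
    finally have "pmf p k * (- L k - ln (pmf p k)) \<le> pmf w k - pmf p k"
      using pos w_pos[of k] by (simp add: ln_div ln_w)
    then have "- (pmf p k * ln (pmf p k)) \<le> pmf w k + pmf p k * L k"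
      using pos by (simp add: algebra_simps)
    moreover have "pmf p k * ln (pmf p k) \<le> 0"
      using pos pmf_le_1[of p k] by (intro mult_nonneg_nonpos) auto
    ultimately show ?thesis by simp
  qed
  have "integrable (measure_pmf p) (\<lambda>k. real (k $ j))" for j
    using integrable_bounded_linear[OF bounded_linear_vec_nth[of j] assms]
    by (simp add: real_vec_def)
  then have "integrable (measure_pmf p) L"
    unfolding L_def by (intro Bochner_Integration.integrable_sum) auto
  then have "integrable (count_space UNIV) (\<lambda>k. pmf p k *\<^sub>R L k)"
    unfolding measure_pmf_eq_density by (subst (asm) integrable_density) auto
  then have "Infinite_Set_Sum.abs_summable_on (\<lambda>k. pmf p k * L k) UNIV"
    by (simp add: abs_summable_on_def)
  then have s1: "(\<lambda>k. pmf p k * L k) summable_on UNIV"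
    using abs_summable_equivalent abs_summable_summable by blast
  have s2: "pmf w summable_on UNIV"
    using pmf_abs_summable abs_summable_equivalent abs_summable_summable by blast
  show ?thesis
    by (rule abs_summable_summable, rule summable_on_comparison_test[OF summable_on_add[OF s2 s1]])
      (use bound in auto)
qed

end

theory Submission
  imports Defs
begin

text \<open>
  Let \<open>y\<close> be an integer point of \<open>P\<close>. Mixing a maximum entropy law \<open>p\<close> with the point mass at
  \<open>y\<close> stays feasible, and the first variation of the entropy in this direction is
  \<open>- ln (p y) - H p\<close>, so maximality forces \<open>p y \<ge> exp (- H p)\<close>. By Gibbs' inequality the product
  of the marginals of \<open>p\<close> is again a maximum entropy law, with the same entropy, so one may assume
  independent coordinates. If the columns indexed by \<open>J\<close> form a basis, an integer point of \<open>P\<close> is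
  determined by its coordinates outside \<open>J\<close>; since a geometric mass function is largest at 0,
  independence bounds the total mass of the integer points by \<open>\<Prod>j\<in>J. 1 - q j\<close>.
\<close>

section \<open>Expectations over the counting measure and Gibbs' inequality\<close>

text \<open>Against the counting measure, expectations under different laws become integrals over
  one measure, so masses of two laws can be compared pointwise and then integrated.\<close>

lemma integrable_measure_pmf_iff:
  fixes f :: "'a \<Rightarrow> 'b::{banach, second_countable_topology}"
  shows "integrable (measure_pmf p) f \<longleftrightarrow> integrable (count_space UNIV) (\<lambda>x. pmf p x *\<^sub>R f x)"
  unfolding measure_pmf_eq_density by (subst integrable_density) auto

lemma expectation_pmf_eq_count_space:
  fixes f :: "'a \<Rightarrow> 'b::{banach, second_countable_topology}"
  shows "measure_pmf.expectation p f = (\<integral>x. pmf p x *\<^sub>R f x \<partial>count_space UNIV)"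
  unfolding measure_pmf_eq_density by (subst integral_density) auto

text \<open>Apply \<open>ln u \<le> u - 1\<close> to \<open>u = pmf r x / pmf p x\<close>; the error
  term \<open>pmf r x - pmf p x\<close> integrates to 0. The support condition matters: where only
  \<open>pmf r x\<close> vanishes, the default \<open>ln 0 = 0\<close> would stand in for minus
  infinity.\<close>

lemma gibbs_inequality:
  fixes p r :: "'a pmf"
  assumes p: "integrable (measure_pmf p) (\<lambda>x. ln (pmf p x))"
    and r: "integrable (measure_pmf p) (\<lambda>x. ln (pmf r x))"
    and supp: "set_pmf p \<subseteq> set_pmf r"
  shows "measure_pmf.expectation p (\<lambda>x. ln (pmf r x))
    \<le> measure_pmf.expectation p (\<lambda>x. ln (pmf p x))"
proof -
  have pt: "pmf p x * ln (pmf r x) \<le> pmf p x * ln (pmf p x) + (pmf r x - pmf p x)" for x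
  proof (cases "pmf p x = 0")
    case False
    then have pp: "pmf p x > 0" by (simp add: pmf_pos)
    have rp: "pmf r x > 0" using False supp by (auto simp: set_pmf_eq pmf_pos)
    have "ln (pmf r x / pmf p x) \<le> pmf r x / pmf p x - 1"
      using pp rp by (intro ln_le_minus_one) simp
    then have "pmf p x * ln (pmf r x / pmf p x) \<le> pmf p x * (pmf r x / pmf p x - 1)"
      using pp by (intro mult_left_mono) auto
    also have "\<dots> = pmf r x - pmf p x" using pp by (simp add: field_simps)
    finally show ?thesis using pp rp by (simp add: ln_div algebra_simps)
  qed simp
  have one: "(\<integral>x. pmf s x \<partial>count_space UNIV) = 1" for s :: "'a pmf"
    using expectation_pmf_eq_count_space[of s "\<lambda>_. 1::real"] by simp
  have "(\<integral>x. pmf p x * ln (pmf r x) \<partial>count_space UNIV)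
      \<le> (\<integral>x. pmf p x * ln (pmf p x) + (pmf r x - pmf p x) \<partial>count_space UNIV)"
    using p r pt by (intro integral_mono) (auto simp: integrable_measure_pmf_iff integrable_pmf)
  also have "\<dots> = (\<integral>x. pmf p x * ln (pmf p x) \<partial>count_space UNIV)"
    using p by (simp add: integrable_measure_pmf_iff integrable_pmf one)
  finally show ?thesis by (simp add: expectation_pmf_eq_count_space)
qed

section \<open>Mixtures with a point mass\<close>

definition mix_point :: "real \<Rightarrow> 'a \<Rightarrow> 'a pmf \<Rightarrow> 'a pmf" where
  "mix_point t y p = bind_pmf (bernoulli_pmf t) (\<lambda>c. if c then return_pmf y else p)"

lemma pmf_mix_point:
  assumes "0 \<le> t" "t \<le> 1"
  shows "pmf (mix_point t y p) x = (1 - t) * pmf p x + t * indicator {y} x"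
  using assms by (simp add: mix_point_def pmf_bind indicator_def)

lemma
  fixes f :: "'a \<Rightarrow> 'b::{banach, second_countable_topology}"
  assumes t: "0 \<le> t" "t \<le> 1" and f: "integrable (measure_pmf p) f"
  shows integrable_mix_point: "integrable (measure_pmf (mix_point t y p)) f"
    and expectation_mix_point: "measure_pmf.expectation (mix_point t y p) f
      = (1 - t) *\<^sub>R measure_pmf.expectation p f + t *\<^sub>R f y"
proof -
  have eq: "(\<lambda>x. pmf (mix_point t y p) x *\<^sub>R f x)
      = (\<lambda>x. (1 - t) *\<^sub>R (pmf p x *\<^sub>R f x) + indicator {y} x *\<^sub>R (t *\<^sub>R f y))"
    using t by (auto simp: pmf_mix_point fun_eq_iff indicator_def scaleR_add_left)
  have pt: "has_bochner_integral (count_space UNIV) (\<lambda>x. indicator {y} x *\<^sub>R (t *\<^sub>R f y)) (t *\<^sub>R f y)"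
    using has_bochner_integral_indicator[of "{y}" "count_space UNIV" "t *\<^sub>R f y"] by simp
  show "integrable (measure_pmf (mix_point t y p)) f"
    unfolding integrable_measure_pmf_iff eq
    using f pt by (intro Bochner_Integration.integrable_add integrable_scaleR_right)
      (auto simp: integrable_measure_pmf_iff has_bochner_integral_iff)
  show "measure_pmf.expectation (mix_point t y p) f
      = (1 - t) *\<^sub>R measure_pmf.expectation p f + t *\<^sub>R f y"
    unfolding expectation_pmf_eq_count_space eq
    using f pt by (subst Bochner_Integration.integral_add)
      (auto simp: integrable_measure_pmf_iff has_bochner_integral_iff simp del: scaleR_scaleR)
qed

text \<open>For \<open>t < 1\<close> the mass of \<open>p\<close> is at most
  \<open>1 / (1 - t)\<close> times that of the mixture. This carries integrability of the logarithm
  of the mixture's mass, known under the mixture, over to \<open>p\<close>.\<close>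

lemma integrable_of_mix_point:
  fixes f :: "'a \<Rightarrow> 'b::{banach, second_countable_topology}"
  assumes t: "0 \<le> t" "t < 1" and f: "integrable (measure_pmf (mix_point t y p)) f"
  shows "integrable (measure_pmf p) f"
proof -
  have "integrable (count_space UNIV) (\<lambda>x. (1 / (1 - t)) *\<^sub>R (pmf (mix_point t y p) x *\<^sub>R f x))"
    using f by (intro integrable_scaleR_right) (auto simp: integrable_measure_pmf_iff)
  then show ?thesis
    unfolding integrable_measure_pmf_iff
  proof (rule Bochner_Integration.integrable_bound)
    have "norm (pmf p x *\<^sub>R f x) \<le> norm ((1 / (1 - t)) *\<^sub>R (pmf (mix_point t y p) x *\<^sub>R f x))" for x
    proof -
      have "pmf p x \<le> pmf (mix_point t y p) x / (1 - t)"
        using t by (auto simp: pmf_mix_point field_simps indicator_def)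
      then have "pmf p x * norm (f x) \<le> (pmf (mix_point t y p) x / (1 - t)) * norm (f x)"
        by (rule mult_right_mono) simp
      then show ?thesis using t by simp
    qed
    then show "AE x in count_space UNIV. norm (pmf p x *\<^sub>R f x)
        \<le> norm ((1 / (1 - t)) *\<^sub>R (pmf (mix_point t y p) x *\<^sub>R f x))"
      by simp
  qed simp
qed

section \<open>Entropy and feasibility as expectations\<close>

text \<open>Summability of reals is absolute here, so \<open>entropy_summable\<close> turns the sum
  defining the entropy into a genuine Bochner integral, to which linearity and Gibbs' inequality
  apply.\<close>

lemma
  assumes "integrable (measure_pmf p) real_vec"
  shows integrable_ln_pmf: "integrable (measure_pmf p) (\<lambda>k. ln (pmf p k))"
    and entropy_H_eq_expectation:
      "entropy_H p = - measure_pmf.expectation p (\<lambda>k. ln (pmf p k))"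
proof -
  have "(\<lambda>k. norm (pmf p k * ln (pmf p k))) summable_on UNIV"
    using entropy_summable[OF assms] by (rule summable_on_iff_abs_summable_on_real[THEN iffD1])
  then have s: "Infinite_Set_Sum.abs_summable_on (\<lambda>k. pmf p k * ln (pmf p k)) UNIV"
    by (rule abs_summable_equivalent[THEN iffD1])
  then show "integrable (measure_pmf p) (\<lambda>k. ln (pmf p k))"
    by (simp add: integrable_measure_pmf_iff Infinite_Set_Sum.abs_summable_on_def)
  show "entropy_H p = - measure_pmf.expectation p (\<lambda>k. ln (pmf p k))"
    unfolding entropy_H_def infsetsum_infsum[OF s, symmetric]
    by (simp add: expectation_pmf_eq_count_space infsetsum_def)
qed

lemma integrable_real_vec_iff:
  fixes p :: "(nat^'n) pmf"
  shows "integrable (measure_pmf p) real_vec \<longleftrightarrow> (\<forall>j. integrable (measure_pmf p) (\<lambda>k. real (k $ j)))"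
proof
  assume *: "integrable (measure_pmf p) real_vec"
  show "\<forall>j. integrable (measure_pmf p) (\<lambda>k. real (k $ j))"
    using integrable_bounded_linear[OF bounded_linear_vec_nth *] by (simp add: real_vec_def)
next
  assume *: "\<forall>j. integrable (measure_pmf p) (\<lambda>k. real (k $ j))"
  have "(real_vec :: nat^'n \<Rightarrow> real^'n) = (\<lambda>k. \<Sum>j\<in>UNIV. real (k $ j) *\<^sub>R axis j 1)"
    by (auto simp: fun_eq_iff real_vec_def vec_eq_iff axis_def if_distrib cong: if_cong)
  moreover have "integrable (measure_pmf p) (\<lambda>k. \<Sum>j\<in>UNIV. real (k $ j) *\<^sub>R (axis j 1 :: real^'n))"
    using * by (intro Bochner_Integration.integrable_sum integrable_scaleR_left) auto
  ultimately show "integrable (measure_pmf p) real_vec" by (simp only:)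
qed

text \<open>The linear map \<open>A\<close> commutes with the expectation, so feasibility depends
  only on the mean vector and its existence.\<close>

lemma feasible_law_iff:
  "feasible_law A b p \<longleftrightarrow> integrable (measure_pmf p) real_vec \<and>
     A *v measure_pmf.expectation p real_vec = b"
  unfolding feasible_law_def
  using integral_bounded_linear[OF matrix_vector_mul_bounded_linear[of A], of "measure_pmf p" real_vec]
  by auto

lemma expectation_real_vec_nth:
  assumes "integrable (measure_pmf p) real_vec"
  shows "measure_pmf.expectation p real_vec $ j = measure_pmf.expectation p (\<lambda>k. real (k $ j))"
  using integral_bounded_linear[OF bounded_linear_vec_nth[of j] assms]
  by (simp add: real_vec_def)

section \<open>Lower bound for the mass at a feasible point\<close>

text \<open>No derivative is taken: Gibbs' inequality bounds the entropy of the mixture from below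
  by \<open>(1 - t) * entropy_H p - t * ln (pmf ?m y)\<close>, and maximality bounds it from above
  by \<open>entropy_H p\<close>. This also covers a priori the case \<open>pmf p y = 0\<close>,
  which it excludes.\<close>

lemma max_entropy_pmf_lower_bound:
  assumes p: "max_entropy_law A b p" and y: "A *v real_vec y = b"
  shows "exp (- entropy_H p) \<le> pmf p y"
proof -
  have fp: "feasible_law A b p" and mx: "\<And>p'. feasible_law A b p' \<Longrightarrow> entropy_H p' \<le> entropy_H p"
    using p by (auto simp: max_entropy_law_def)
  have ip: "integrable (measure_pmf p) real_vec" and ep: "A *v measure_pmf.expectation p real_vec = b"
    using fp by (auto simp: feasible_law_iff)
  have bound: "exp (- entropy_H p) \<le> (1 - t) * pmf p y + t" if t: "0 < t" "t < 1" for t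
  proof -
    let ?m = "mix_point t y p"
    have im: "integrable (measure_pmf ?m) real_vec"
      using t ip by (intro integrable_mix_point) auto
    have "feasible_law A b ?m"
      using t im ip ep y
      by (simp add: feasible_law_iff expectation_mix_point matrix_vector_right_distrib
          matrix_vector_mult_scaleR flip: scaleR_add_left)
    then have le: "entropy_H ?m \<le> entropy_H p" by (rule mx)
    have il: "integrable (measure_pmf p) (\<lambda>k. ln (pmf ?m k))"
      using integrable_of_mix_point[OF _ _ integrable_ln_pmf[OF im]] t by auto
    \<comment> \<open>The weight \<open>1 - t > 0\<close> keeps the support of \<open>p\<close>
      inside that of the mixture, as Gibbs' inequality requires.\<close>
    have "measure_pmf.expectation p (\<lambda>k. ln (pmf ?m k)) \<le> - entropy_H p"
      unfolding entropy_H_eq_expectation[OF ip]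
      using gibbs_inequality[OF integrable_ln_pmf[OF ip] il] t
      by (force simp: set_pmf_eq pmf_mix_point indicator_def add_nonneg_eq_0_iff)
    then have "(1 - t) * measure_pmf.expectation p (\<lambda>k. ln (pmf ?m k)) \<le> (1 - t) * (- entropy_H p)"
      using t by (intro mult_left_mono) auto
    moreover have "entropy_H ?m
        = - ((1 - t) * measure_pmf.expectation p (\<lambda>k. ln (pmf ?m k)) + t * ln (pmf ?m y))"
      unfolding entropy_H_eq_expectation[OF im] using t il by (subst expectation_mix_point) auto
    \<comment> \<open>The terms with factor \<open>1 - t\<close> combine with maximality, and only a
      multiple of \<open>t\<close> is left to cancel.\<close>
    ultimately have "t * (- entropy_H p) \<le> t * ln (pmf ?m y)"
      using le by (simp add: algebra_simps)
    then have "- entropy_H p \<le> ln (pmf ?m y)" using t by (simp only: mult_le_cancel_left_pos)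
    moreover have m: "pmf ?m y = (1 - t) * pmf p y + t" using t by (simp add: pmf_mix_point)
    moreover have "0 < (1 - t) * pmf p y + t" using t by (simp add: add_nonneg_pos)
    ultimately show ?thesis by (metis exp_le_cancel_iff exp_ln)
  qed
  \<comment> \<open>Letting \<open>t\<close> tend to 0 from the right removes the contribution of
    the added point mass.\<close>
  have "((\<lambda>t. (1 - t) * pmf p y + t) \<longlongrightarrow> (1 - 0) * pmf p y + 0) (at_right 0)"
    by (intro tendsto_intros)
  moreover have "eventually (\<lambda>t. exp (- entropy_H p) \<le> (1 - t) * pmf p y + t) (at_right 0)"
    using bound by (auto simp: eventually_at_right_field intro!: exI[of _ 1])
  ultimately show ?thesis
    using tendsto_lowerbound[of _ _ "at_right (0::real)"] by fastforce
qed

section \<open>Passing to independent coordinates\<close>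

definition product_of_marginals :: "(nat^'n) pmf \<Rightarrow> (nat^'n) pmf" where
  "product_of_marginals p =
     map_pmf vec_lambda (Pi_pmf UNIV 0 (\<lambda>j. map_pmf (\<lambda>x. x $ j) p))"

lemma pmf_product_of_marginals:
  fixes p :: "(nat^'n) pmf"
  shows "pmf (product_of_marginals p) k = (\<Prod>j\<in>UNIV. pmf (map_pmf (\<lambda>x. x $ j) p) (k $ j))"
proof -
  have "inj (vec_lambda :: ('n \<Rightarrow> nat) \<Rightarrow> nat^'n)"
    by (rule injI) (metis vec_lambda_inverse UNIV_I)
  then have "pmf (product_of_marginals p) (vec_lambda (vec_nth k))
      = pmf (Pi_pmf (UNIV :: 'n set) 0 (\<lambda>j. map_pmf (\<lambda>x. x $ j) p)) (vec_nth k)"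
    unfolding product_of_marginals_def by (rule pmf_map_inj')
  then show ?thesis by (simp add: pmf_Pi)
qed

lemma marginal_product_of_marginals:
  "map_pmf (\<lambda>x. x $ j) (product_of_marginals p) = map_pmf (\<lambda>x. x $ j) p"
  by (simp add: product_of_marginals_def pmf.map_comp o_def Pi_pmf_component)

lemma set_pmf_product_of_marginals: "set_pmf p \<subseteq> set_pmf (product_of_marginals p)"
proof
  fix k assume "k \<in> set_pmf p"
  then have "k $ j \<in> set_pmf (map_pmf (\<lambda>x. x $ j) p)" for j by simp
  then have "pmf (map_pmf (\<lambda>x. x $ j) p) (k $ j) \<noteq> 0" for j
    by (simp only: set_pmf_iff not_False_eq_True)
  then show "k \<in> set_pmf (product_of_marginals p)"
    unfolding set_pmf_iff pmf_product_of_marginals by simp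
qed

lemma
  fixes f :: "nat \<Rightarrow> real"
  shows integrable_product_of_marginals_nth:
      "integrable (measure_pmf (product_of_marginals p)) (\<lambda>x. f (x $ j))
       \<longleftrightarrow> integrable (measure_pmf p) (\<lambda>x. f (x $ j))"
    and expectation_product_of_marginals_nth:
      "measure_pmf.expectation (product_of_marginals p) (\<lambda>x. f (x $ j))
       = measure_pmf.expectation p (\<lambda>x. f (x $ j))"
proof -
  note eq = marginal_product_of_marginals[of j p]
  show "integrable (measure_pmf (product_of_marginals p)) (\<lambda>x. f (x $ j))
       \<longleftrightarrow> integrable (measure_pmf p) (\<lambda>x. f (x $ j))"
    using arg_cong[OF eq, of "\<lambda>m. integrable (measure_pmf m) f"]
    by (simp add: integrable_map_pmf_eq)
  show "measure_pmf.expectation (product_of_marginals p) (\<lambda>x. f (x $ j))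
       = measure_pmf.expectation p (\<lambda>x. f (x $ j))"
    using arg_cong[OF eq, of "\<lambda>m. measure_pmf.expectation m f"] by simp
qed

text \<open>The mean vector sees only the one-dimensional marginals, which \<open>p\<close> and the
  product share.\<close>

lemma feasible_product_of_marginals:
  assumes "feasible_law A b p"
  shows "feasible_law A b (product_of_marginals p)"
proof -
  have ip: "integrable (measure_pmf p) real_vec" using assms by (simp add: feasible_law_iff)
  then have ir: "integrable (measure_pmf (product_of_marginals p)) real_vec"
    by (simp add: integrable_real_vec_iff integrable_product_of_marginals_nth[where f = real])
  have "measure_pmf.expectation (product_of_marginals p) real_vec
      = measure_pmf.expectation p real_vec"
    by (simp add: vec_eq_iff expectation_real_vec_nth ip ir
        expectation_product_of_marginals_nth[where f = real])
  then show ?thesis using assms ir by (simp add: feasible_law_iff)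
qed

text \<open>For geometric marginals the log-mass of the product is an affine function
  \<open>L\<close> of the coordinates, so it has the same expectation under both laws. Gibbs'
  inequality for \<open>p\<close> against the product then compares the entropies.\<close>

lemma entropy_product_of_marginals_ge:
  fixes p :: "(nat^'n) pmf" and q :: "'n \<Rightarrow> real"
  assumes ip: "integrable (measure_pmf p) real_vec"
    and q: "\<And>j. 0 \<le> q j \<and> q j < 1"
    and marg: "\<And>j k. pmf (map_pmf (\<lambda>x. x $ j) p) k = (1 - q j) * q j ^ k"
  shows "entropy_H p \<le> entropy_H (product_of_marginals p)"
proof -
  let ?r = "product_of_marginals p"
  define L where "L k = (\<Sum>j\<in>UNIV. ln (1 - q j) + real (k $ j) * ln (q j))" for k :: "nat^'n"
  have ir: "integrable (measure_pmf ?r) real_vec"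
    using ip by (simp add: integrable_real_vec_iff integrable_product_of_marginals_nth[where f = real])
  \<comment> \<open>The restriction to the support is needed: off it some factor vanishes, and
    \<open>ln 0 = 0\<close> need not agree with \<open>L k\<close>.\<close>
  have ln_r: "ln (pmf ?r k) = L k" if "k \<in> set_pmf ?r" for k
  proof -
    have pos: "(1 - q j) * q j ^ (k $ j) > 0" for j
    proof -
      have "(1 - q j) * q j ^ (k $ j) \<noteq> 0"
        using that unfolding set_pmf_iff pmf_product_of_marginals marg by simp
      moreover have "(1 - q j) * q j ^ (k $ j) \<ge> 0" using q[of j] by simp
      ultimately show ?thesis by linarith
    qed
    have "ln ((1 - q j) * q j ^ (k $ j)) = ln (1 - q j) + real (k $ j) * ln (q j)" for j
    proof (cases "q j = 0")
      case True
      \<comment> \<open>A positive factor with \<open>q j = 0\<close> forces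
        \<open>k $ j = 0\<close>, and both sides are 0.\<close>
      then show ?thesis using pos[of j] by (cases "k $ j") auto
    next
      case False
      then show ?thesis using q[of j] by (simp add: ln_mult ln_realpow)
    qed
    moreover have "ln (pmf ?r k) = (\<Sum>j\<in>UNIV. ln ((1 - q j) * q j ^ (k $ j)))"
      unfolding pmf_product_of_marginals marg using less_imp_neq[OF pos] by (intro ln_prod finite) metis
    ultimately show ?thesis by (simp add: L_def)
  qed
  have Lp: "integrable (measure_pmf p) L"
    using ip unfolding L_def integrable_real_vec_iff
    by (intro Bochner_Integration.integrable_sum Bochner_Integration.integrable_add) auto
  have Lr: "measure_pmf.expectation ?r L = measure_pmf.expectation p L"
    using ip ir unfolding L_def integrable_real_vec_iff
    by (simp add: expectation_product_of_marginals_nth[where f = real])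
  have aep: "AE k in measure_pmf p. ln (pmf ?r k) = L k"
    using set_pmf_product_of_marginals[of p] ln_r by (auto simp: AE_measure_pmf_iff)
  have aer: "AE k in measure_pmf ?r. ln (pmf ?r k) = L k"
    using ln_r by (auto simp: AE_measure_pmf_iff)
  have "integrable (measure_pmf p) (\<lambda>k. ln (pmf ?r k))"
    using Lp aep integrable_cong_AE[of "\<lambda>k. ln (pmf ?r k)" "measure_pmf p" L] by simp
  then have "measure_pmf.expectation p (\<lambda>k. ln (pmf ?r k))
      \<le> measure_pmf.expectation p (\<lambda>k. ln (pmf p k))"
    using integrable_ln_pmf[OF ip] set_pmf_product_of_marginals by (intro gibbs_inequality)
  moreover have "measure_pmf.expectation p (\<lambda>k. ln (pmf ?r k)) = measure_pmf.expectation p L"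
    using aep by (intro integral_cong_AE) auto
  moreover have "measure_pmf.expectation ?r (\<lambda>k. ln (pmf ?r k)) = measure_pmf.expectation ?r L"
    using aer by (intro integral_cong_AE) auto
  ultimately show ?thesis
    by (simp add: entropy_H_eq_expectation ip ir Lr)
qed

section \<open>Column bases\<close>

text \<open>A basis of the column span can be chosen among the columns, and one index per basis
  vector gives \<open>J\<close>. This makes the minimum in the theorem meaningful.\<close>

lemma column_bases_nonempty:
  fixes A :: "real^'n^'m"
  assumes "rank A = CARD('m)"
  shows "column_bases A \<noteq> {}"
proof -
  obtain B where B: "B \<subseteq> columns A" "independent B" "card B = dim (columns A)"
    using basis_exists by metis
  have "B \<subseteq> (\<lambda>j. column j A) ` UNIV" using B(1) by (auto simp: columns_def)
  then obtain J where J: "inj_on (\<lambda>j. column j A) J" "B = (\<lambda>j. column j A) ` J"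
    using subset_image_inj by metis
  then have "J \<in> column_bases A"
    using B assms card_image[OF J(1)] by (auto simp: column_bases_def column_rank_def)
  then show ?thesis by blast
qed

text \<open>The difference \<open>x - y\<close> lies in the kernel of \<open>A\<close> and is
  supported on \<open>J\<close>, so its entries are the coefficients of a linear relation among
  independent columns.\<close>

lemma eq_if_eq_outside_column_basis:
  fixes A :: "real^'n^'m"
  assumes J: "J \<in> column_bases A" and eq: "A *v x = A *v y"
    and off: "\<And>j. j \<notin> J \<Longrightarrow> x $ j = y $ j"
  shows "x = y"
proof -
  have inj: "inj_on (\<lambda>j. column j A) J" and ind: "independent ((\<lambda>j. column j A) ` J)"
    using J by (auto simp: column_bases_def)
  have "0 = A *v (x - y)" using eq by (simp add: matrix_vector_mult_diff_distrib)
  also have "\<dots> = (\<Sum>j\<in>UNIV. (x - y) $ j *\<^sub>R column j A)"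
    by (simp add: matrix_mult_sum scalar_mult_eq_scaleR)
  also have "\<dots> = (\<Sum>j\<in>J. (x - y) $ j *\<^sub>R column j A)"
    using off by (intro sum.mono_neutral_right) auto
  \<comment> \<open>Independence speaks of a set of vectors, so the coefficients are reindexed by
    the columns through the inverse of the injective column map.\<close>
  also have "\<dots> = (\<Sum>v\<in>(\<lambda>j. column j A) ` J.
      (x - y) $ (the_inv_into J (\<lambda>j. column j A) v) *\<^sub>R v)"
    by (simp add: sum.reindex[OF inj] the_inv_into_f_f[OF inj])
  finally have "(\<Sum>v\<in>(\<lambda>j. column j A) ` J.
      (x - y) $ (the_inv_into J (\<lambda>j. column j A) v) *\<^sub>R v) = 0" by simp
  then have "(x - y) $ the_inv_into J (\<lambda>j. column j A) (column j A) = 0" if "j \<in> J" for j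
    using that by (intro independentD[OF ind _ subset_refl]) auto
  then have "(x - y) $ j = 0" if "j \<in> J" for j
    using that by (simp add: the_inv_into_f_f[OF inj])
  with off show ?thesis by (fastforce simp: vec_eq_iff)
qed

section \<open>Counting integer points\<close>

text \<open>Each factor with index in \<open>J\<close> is at most its value \<open>1 - q j\<close>
  at 0. What remains is the mass of the coordinates outside \<open>J\<close>, and these determine a
  solution, so the remaining masses add up to at most 1.\<close>

lemma sum_pmf_product_of_marginals_le:
  fixes A :: "real^'n^'m"
  assumes J: "J \<in> column_bases A"
    and q: "\<And>j. 0 \<le> q j \<and> q j < 1"
    and marg: "\<And>j k. pmf (map_pmf (\<lambda>x. x $ j) p) k = (1 - q j) * q j ^ k"
    and F: "finite F" "F \<subseteq> {k. A *v real_vec k = b}"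
  shows "(\<Sum>k\<in>F. pmf (product_of_marginals p) k) \<le> (\<Prod>j\<in>J. 1 - q j)"
proof -
  define D where "D = Pi_pmf (- J) 0 (\<lambda>j. map_pmf (\<lambda>x. x $ j) p)"
  \<comment> \<open>Setting the entries in \<open>J\<close> to 0, the default value of
    \<open>Pi_pmf\<close> in \<open>D\<close>, makes \<open>pmf D (\<pi> k)\<close> the product of
    the marginal masses outside \<open>J\<close>.\<close>
  define \<pi> where "\<pi> k = (\<lambda>j. if j \<in> J then 0 else k $ j)" for k :: "nat^'n"
  have "inj_on \<pi> F"
  proof (rule inj_onI)
    fix k l assume kl: "k \<in> F" "l \<in> F" "\<pi> k = \<pi> l"
    have "k $ j = l $ j" if "j \<notin> J" for j
      using fun_cong[OF kl(3), of j] that by (simp add: \<pi>_def)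
    then have "real_vec k = real_vec l"
      using kl F by (intro eq_if_eq_outside_column_basis[OF J]) (auto simp: real_vec_def)
    then show "k = l" by (simp add: real_vec_def vec_eq_iff)
  qed
  then have "(\<Sum>k\<in>F. pmf D (\<pi> k)) = measure (measure_pmf D) (\<pi> ` F)"
    using F by (simp add: measure_measure_pmf_finite sum.reindex)
  then have le1: "(\<Sum>k\<in>F. pmf D (\<pi> k)) \<le> 1" by simp
  have nn: "0 \<le> (\<Prod>j\<in>J. 1 - q j)" using q by (intro prod_nonneg) (auto simp: less_imp_le)
  have "pmf (product_of_marginals p) k \<le> (\<Prod>j\<in>J. 1 - q j) * pmf D (\<pi> k)" for k
  proof -
    have "(\<Prod>j\<in>- J. pmf (map_pmf (\<lambda>x. x $ j) p) (k $ j)) = pmf D (\<pi> k)"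
      unfolding D_def by (subst pmf_Pi') (auto simp: \<pi>_def intro!: prod.cong)
    then have "pmf (product_of_marginals p) k
        = (\<Prod>j\<in>J. (1 - q j) * q j ^ (k $ j)) * pmf D (\<pi> k)"
      using prod.subset_diff[of J UNIV "\<lambda>j. pmf (map_pmf (\<lambda>x. x $ j) p) (k $ j)"]
      by (simp add: pmf_product_of_marginals Compl_eq_Diff_UNIV marg mult.commute)
    moreover have "(\<Prod>j\<in>J. (1 - q j) * q j ^ (k $ j)) \<le> (\<Prod>j\<in>J. 1 - q j)"
      using q by (intro prod_mono) (auto simp: less_imp_le power_le_one mult_left_le)
    ultimately show ?thesis by (simp add: mult_right_mono)
  qed
  then have "(\<Sum>k\<in>F. pmf (product_of_marginals p) k)
      \<le> (\<Prod>j\<in>J. 1 - q j) * (\<Sum>k\<in>F. pmf D (\<pi> k))"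
    by (simp add: sum_distrib_left sum_mono)
  also have "\<dots> \<le> (\<Prod>j\<in>J. 1 - q j)" using mult_left_le[OF le1 nn] by simp
  finally show ?thesis .
qed

text \<open>Nonnegative integer entries are exactly the casts of naturals, which moves the count to
  the space carrying the laws.\<close>

lemma integer_points_of_polyhedron_P:
  "polyhedron_P A b \<inter> integer_points = real_vec ` {k. A *v real_vec k = b}"
proof (intro equalityI subsetI)
  fix x assume x: "x \<in> polyhedron_P A b \<inter> integer_points"
  have "real_vec (\<chi> j. nat \<lfloor>x $ j\<rfloor>) = x"
    using x by (auto simp: polyhedron_P_def integer_points_def real_vec_def vec_eq_iff)
  then show "x \<in> real_vec ` {k. A *v real_vec k = b}"
    using x by (intro image_eqI[of _ _ "\<chi> j. nat \<lfloor>x $ j\<rfloor>"]) (auto simp: polyhedron_P_def)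
qed (auto simp: polyhedron_P_def integer_points_def real_vec_def)

theorem theorem1:
  fixes A :: "real^'n^'m" and b :: "real^'m" and p :: "(nat^'n) pmf" and q z :: "'n \<Rightarrow> real"
  assumes "CARD('m) < CARD('n)"
    and "rank A = CARD('m)"
    and "max_entropy_law A b p"
    and "\<And>j. 0 \<le> q j \<and> q j < 1"
    and "\<And>j k. measure_pmf.prob p {x. x $ j = k} = (1 - q j) * q j ^ k"
    and "\<And>j. z j = measure_pmf.expectation p (\<lambda>x. real (x $ j))"
  shows "finite (polyhedron_P A b \<inter> integer_points) \<and>
    real (card (polyhedron_P A b \<inter> integer_points))
      \<le> exp (entropy_H p) * Min ((\<lambda>J. \<Prod>j\<in>J. 1 - q j) ` column_bases A) \<and>
    exp (entropy_H p) * Min ((\<lambda>J. \<Prod>j\<in>J. 1 - q j) ` column_bases A)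
      = exp (entropy_H p) * Min ((\<lambda>J. \<Prod>j\<in>J. 1 / (z j + 1)) ` column_bases A)"
proof -
  let ?r = "product_of_marginals p"
  let ?S = "{k. A *v real_vec k = b}"
  have marg: "pmf (map_pmf (\<lambda>x. x $ j) p) k = (1 - q j) * q j ^ k" for j k
    using assms(5)[of j k] by (simp add: pmf_map vimage_def)
  have fp: "feasible_law A b p" and mx: "\<And>p'. feasible_law A b p' \<Longrightarrow> entropy_H p' \<le> entropy_H p"
    using assms(3) by (auto simp: max_entropy_law_def)
  have fr: "feasible_law A b ?r" using fp by (rule feasible_product_of_marginals)
  \<comment> \<open>One inequality is maximality of \<open>p\<close>, the other is Gibbs'
    inequality; hence the product is itself a maximum entropy law.\<close>
  have H: "entropy_H ?r = entropy_H p"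
    using mx[OF fr] entropy_product_of_marginals_ge[of p q] fp assms(4) marg
    by (auto simp: feasible_law_iff)
  have mr: "max_entropy_law A b ?r" using fr mx H by (simp add: max_entropy_law_def)
  have z: "1 / (z j + 1) = 1 - q j" for j
  proof -
    have "map_pmf (\<lambda>x. x $ j) p = geometric_pmf (1 - q j)"
      using assms(4)[of j] by (intro pmf_eqI) (simp add: marg)
    then have "z j = measure_pmf.expectation (geometric_pmf (1 - q j)) real"
      using integral_map_pmf[of "\<lambda>x. x $ j" p real] assms(6)[of j] by simp
    also have "\<dots> = q j / (1 - q j)"
      using assms(4)[of j] by (subst expectation_geometric_pmf) auto
    finally have "z j + 1 = 1 / (1 - q j)" using assms(4)[of j] by (simp add: field_simps)
    then show ?thesis by simp
  qed
  \<comment> \<open>The minimum is attained at some basis \<open>J\<close>, so it suffices to prove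
    the bound for this one.\<close>
  have "Min ((\<lambda>J. \<Prod>j\<in>J. 1 - q j) ` column_bases A) \<in> (\<lambda>J. \<Prod>j\<in>J. 1 - q j) ` column_bases A"
    using column_bases_nonempty[OF assms(2)] by (intro Min_in) auto
  then obtain J where J: "J \<in> column_bases A"
    and Min: "Min ((\<lambda>J. \<Prod>j\<in>J. 1 - q j) ` column_bases A) = (\<Prod>j\<in>J. 1 - q j)"
    by auto
  define C where "C = exp (entropy_H p) * (\<Prod>j\<in>J. 1 - q j)"
  \<comment> \<open>Every point of \<open>F\<close> has mass at least
    \<open>exp (- entropy_H p)\<close>, while the total mass is at most the product over
    \<open>J\<close>. Only finite \<open>F\<close> are treated, as finiteness of \<open>?S\<close>
    is still open.\<close>
  have bd: "real (card F) \<le> C" if F: "F \<subseteq> ?S" "finite F" for F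
  proof -
    have "real (card F) * exp (- entropy_H p) = (\<Sum>k\<in>F. exp (- entropy_H ?r))" by (simp add: H)
    also have "\<dots> \<le> (\<Sum>k\<in>F. pmf ?r k)"
      using F max_entropy_pmf_lower_bound[OF mr] by (intro sum_mono) auto
    also have "\<dots> \<le> (\<Prod>j\<in>J. 1 - q j)"
      using sum_pmf_product_of_marginals_le[OF J assms(4) marg] F by blast
    finally show ?thesis by (simp add: C_def exp_minus field_simps)
  qed
  \<comment> \<open>A uniform bound on the sizes of finite subsets forces finiteness. Without it the
    cardinality bound would be hollow, since \<open>card\<close> of an infinite set is 0.\<close>
  have fin: "finite ?S"
    using finite_if_finite_subsets_card_bdd[of ?S "nat \<lfloor>C\<rfloor>"] bd by (simp add: le_nat_floor)
  have "real (card (real_vec ` ?S)) \<le> C"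
    using bd[OF subset_refl fin] card_image_le[OF fin, of real_vec] by linarith
  then show ?thesis
    using fin by (simp add: integer_points_of_polyhedron_P z Min C_def)
qed

end
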